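(* Let $V$, $H$ be real Hilbert spaces, $A : V \to H$ a bounded injective linear operator with adjoint $A^* : H \to V$, and $P : H \to H$ a compact orthogonal projector with $\mathrm{Range}\, P \subset \overline{\mathrm{Range}\, A}$. Let $\delta > 0$ and $g^\delta \in H$ with $\|g_\perp^\delta\|_H < \delta$. For any solution $p^\delta \in H$ of the minimization problem $$\inf_{q \in H} \left( \frac{1}{2}\|A^* q\|_V^2 + \delta \|(I-P) q\|_H - (g^\delta, q)_H \right),$$ the element $u^\delta = A^* p^\delta \in V$ is the unique solution of the minimization problem $$\inf_{v \in K_P^\delta} \|v\|_V^2, \qquad K_P^\delta = \{ v \in V : \|Av - g^\delta\|_H \le \delta,\ PAv = Pg^\delta \}.$$
   Context: $g_\perp^\delta$ denotes the orthogonal projection of $g^\delta$ on $(\mathrm{Range}\, A)^\perp \subset H$. $I$ is the identity operator of $H$. $P$ is the orthogonal projector on a closed subspace of $H$. *)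

theory Defs
  imports "HOL-Analysis.Analysis"
begin

(* The point described below is unique whenever W is a subspace, and it exists for every x if W is
   a closed subspace of a Hilbert space; orth_proj is only meant to be used in that situation. *)
definition orth_proj :: "'a::real_inner set \<Rightarrow> 'a \<Rightarrow> 'a" where
  "orth_proj W x = (THE y. y \<in> W \<and> x - y \<in> W\<^sup>\<bottom>)"

definition orthogonal_projector :: "('a::real_inner \<Rightarrow> 'a) \<Rightarrow> bool" where
  "orthogonal_projector P \<longleftrightarrow> (\<exists>W. subspace W \<and> closed W \<and> P = orth_proj W)"

definition compact_operator :: "('a::real_normed_vector \<Rightarrow> 'b::real_normed_vector) \<Rightarrow> bool" where
  "compact_operator T \<longleftrightarrow>
     bounded_linear T \<and> (\<forall>S. bounded S \<longrightarrow> compact (closure (T ` S)))"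

(* For a bounded operator between Hilbert spaces, the library constant adjoint is the usual
   Hilbert space adjoint. *)
definition dual_functional ::
  "('v::real_inner \<Rightarrow> 'h::real_inner) \<Rightarrow> ('h \<Rightarrow> 'h) \<Rightarrow> real \<Rightarrow> 'h \<Rightarrow> 'h \<Rightarrow> real" where
  "dual_functional A P \<delta> g q =
     1/2 * (norm (adjoint A q))\<^sup>2 + \<delta> * norm (q - P q) - g \<bullet> q"

definition feasible_set ::
  "('v::real_inner \<Rightarrow> 'h::real_inner) \<Rightarrow> ('h \<Rightarrow> 'h) \<Rightarrow> real \<Rightarrow> 'h \<Rightarrow> 'v set" where
  "feasible_set A P \<delta> g = {v. norm (A v - g) \<le> \<delta> \<and> P (A v) = P g}"

end

theory Submission
  imports Defs
begin

text \<open>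
  The dual minimizer \<open>p\<close> certifies the optimality of \<open>u = A* p\<close>, as a Lagrange multiplier does, and
  the two first-order conditions at \<open>p\<close> supply everything.

  Moving from \<open>p\<close> in a direction \<open>h\<close> gives, for the residual \<open>r = A u - g\<close>,
  \<open>0 \<le> (r, h) + \<delta> \<parallel>(I - P) h\<parallel>\<close>
  (\<open>dual_minimizer_variational_inequality\<close>). The choice \<open>h = - P r\<close>, which the nonsmooth term
  does not see, yields \<open>P r = 0\<close>; then \<open>h = - r\<close> yields \<open>\<parallel>r\<parallel> \<le> \<delta>\<close>. So \<open>u\<close> is feasible.

  Shrinking \<open>p\<close> gives \<open>\<parallel>u\<parallel>\<^sup>2 \<le> (g, p) - \<delta> \<parallel>(I - P) p\<parallel>\<close> (\<open>dual_minimizer_scaling_inequality\<close>).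
  For feasible \<open>v\<close> the vector \<open>A v - g\<close> has norm at most \<open>\<delta>\<close> and is orthogonal to the range of \<open>P\<close>,
  so the right-hand side is at most \<open>(g, p) + (A v - g, p) = (A v, p) = (v, u)\<close>. Hence
  \<open>\<parallel>u\<parallel>\<^sup>2 \<le> (v, u)\<close>, that is \<open>\<parallel>v - u\<parallel>\<^sup>2 \<le> \<parallel>v\<parallel>\<^sup>2 - \<parallel>u\<parallel>\<^sup>2\<close>, which contains both the
  minimality of \<open>u\<close> and its uniqueness.

  The Hilbert space adjoint and the orthogonal projection are given by a choice and a description
  operator, so their defining properties rest on existence; both follow from the Riesz
  representation theorem on a closed subspace.
\<close>

section \<open>Riesz representation, adjoint and orthogonal projection\<close>

text \<open>
  First-order optimality without differentiation: the increments of a functional that is minimal at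
  the base point determine the sign of its one-sided derivative \<open>a\<close>.
\<close>

lemma nonneg_of_small_quadratic:
  fixes a b :: real
  assumes "\<And>t. 0 < t \<Longrightarrow> t < 1 \<Longrightarrow> 0 \<le> t * a + t\<^sup>2 * b"
  shows "0 \<le> a"
proof (rule tendsto_lowerbound)
  show "((\<lambda>t. a + t * b) \<longlongrightarrow> a) (at_right 0)"
    by (rule tendsto_eq_intros refl | simp)+
  show "\<forall>\<^sub>F t in at_right 0. 0 \<le> a + t * b"
  proof (rule eventually_at_rightI[of 0 1])
    fix t :: real assume t: "t \<in> {0<..<1}"
    then have "0 \<le> t * (a + t * b)"
      using assms[of t] by (simp add: algebra_simps power2_eq_square)
    then show "0 \<le> a + t * b"
      using t by (simp add: zero_le_mult_iff)
  qed simp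
qed simp

text \<open>
  Completing the square, the representing vector is the minimizer over \<open>W\<close> of
  \<open>J w = \<parallel>w\<parallel>\<^sup>2 - 2 f w\<close>. It exists because the parallelogram law makes every
  minimizing sequence Cauchy. With \<open>f = (x, _)\<close> the minimizer is the orthogonal projection of \<open>x\<close>
  on \<open>W\<close>, and \<open>W = UNIV\<close> is the usual Riesz theorem.
\<close>

lemma riesz_representation_on_closed_subspace:
  fixes W :: "'a::{real_inner, complete_space} set" and f :: "'a \<Rightarrow> real"
  assumes W: "subspace W" "closed W" and f: "bounded_linear f"
  shows "\<exists>w\<in>W. \<forall>y\<in>W. w \<bullet> y = f y"
proof -
  interpret f: bounded_linear f by (rule f)
  define J where "J w = (norm w)\<^sup>2 - 2 * f w" for w
  define m where "m = Inf (J ` W)"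
  obtain K where K: "\<And>x. \<bar>f x\<bar> \<le> norm x * K"
    using f.bounded by auto
  have J_lower: "- (K\<^sup>2) \<le> J w" for w
  proof -
    have "0 \<le> (norm w - K)\<^sup>2" by simp
    moreover have "f w \<le> norm w * K" using K[of w] by linarith
    ultimately show ?thesis unfolding J_def by (simp add: power2_diff)
  qed
  have bdd: "bdd_below (J ` W)"
    by (rule bdd_belowI2[of _ "- (K\<^sup>2)"]) (rule J_lower)
  have nonempty: "J ` W \<noteq> {}" using subspace_0[OF W(1)] by auto
  have m_le: "m \<le> J w" if "w \<in> W" for w
    unfolding m_def using bdd that by (simp add: cINF_lower)
  have "\<exists>w\<in>W. J w < m + 1 / Suc n" for n
    using cInf_lessD[OF nonempty, of "m + 1 / Suc n"] unfolding m_def by auto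
  then obtain X where X: "\<And>n. X n \<in> W" "\<And>n. J (X n) < m + 1 / Suc n"
    by metis
  have gap: "(norm (a - b))\<^sup>2 \<le> 2 * (J a - m) + 2 * (J b - m)"
    if ab: "a \<in> W" "b \<in> W" for a b
  proof -
    define c where "c = (1/2) *\<^sub>R (a + b)"
    have "c \<in> W" unfolding c_def using W(1) ab by (intro subspace_mul subspace_add)
    then have "m \<le> J c" by (rule m_le)
    moreover have "4 * J c = (norm (a + b))\<^sup>2 - 4 * f a - 4 * f b"
    proof -
      have "f c = (f a + f b) / 2"
        by (simp only: c_def f.scaleR f.add) simp
      moreover have "norm c = norm (a + b) / 2" by (simp add: c_def)
      ultimately show ?thesis
        unfolding J_def by (simp only: power_divide) (simp add: field_simps)
    qed
    moreover have "(norm (a + b))\<^sup>2 + (norm (a - b))\<^sup>2 = 2 * (norm a)\<^sup>2 + 2 * (norm b)\<^sup>2"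
      by (simp add: power2_norm_eq_inner algebra_simps inner_commute)
    moreover have "J a = (norm a)\<^sup>2 - 2 * f a" "J b = (norm b)\<^sup>2 - 2 * f b"
      unfolding J_def by simp_all
    ultimately show ?thesis by (smt (verit))
  qed
  have "Cauchy X"
  proof (rule metric_CauchyI)
    fix e :: real assume e: "0 < e"
    then obtain N where N: "inverse (real (Suc N)) < e\<^sup>2 / 4"
      using reals_Archimedean[of "e\<^sup>2 / 4"] by auto
    have small: "J (X n) - m < e\<^sup>2 / 4" if "N \<le> n" for n
    proof -
      have "1 / real (Suc n) \<le> inverse (real (Suc N))"
        using that by (simp add: field_simps)
      then show ?thesis using X(2)[of n] N by linarith
    qed
    have "dist (X i) (X j) < e" if "N \<le> i" "N \<le> j" for i j
    proof -
      have "(norm (X i - X j))\<^sup>2 < e\<^sup>2"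
        using gap[OF X(1) X(1), of i j] small[OF that(1)] small[OF that(2)]
        by (simp add: field_simps)
      then show ?thesis using e by (simp add: dist_norm power_less_imp_less_base)
    qed
    then show "\<exists>N. \<forall>i\<ge>N. \<forall>j\<ge>N. dist (X i) (X j) < e" by blast
  qed
  then obtain w where lim: "X \<longlonglongrightarrow> w"
    using Cauchy_convergent_iff convergent_def by blast
  have w: "w \<in> W" using W(2) X(1) lim closed_sequentially by blast
  have "(\<lambda>n. J (X n)) \<longlonglongrightarrow> J w"
    unfolding J_def by (intro tendsto_intros lim f.tendsto)
  moreover have "(\<lambda>n. m + 1 / real (Suc n)) \<longlonglongrightarrow> m + 0"
    using LIMSEQ_inverse_real_of_nat by (intro tendsto_intros) (simp add: inverse_eq_divide)
  ultimately have "J w \<le> m + 0"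
    by (rule LIMSEQ_le) (use X(2) less_imp_le in blast)
  then have minimal: "J w \<le> J z" if "z \<in> W" for z using m_le[OF that] by simp
  \<comment> \<open>one-sided optimality in the direction \<open>y\<close>; using it for \<open>y\<close> and \<open>- y\<close> gives equality\<close>
  have half: "0 \<le> 2 * (w \<bullet> y - f y)" if y: "y \<in> W" for y
  proof (rule nonneg_of_small_quadratic)
    fix t :: real
    have "w + t *\<^sub>R y \<in> W" using W(1) w y by (intro subspace_add subspace_mul)
    from minimal[OF this] show "0 \<le> t * (2 * (w \<bullet> y - f y)) + t\<^sup>2 * (norm y)\<^sup>2"
      unfolding J_def power2_norm_eq_inner
      by (simp add: f.add f.scaleR algebra_simps inner_commute power2_eq_square)
  qed
  show ?thesis
  proof (rule bexI[OF _ w], rule ballI)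
    fix y assume y: "y \<in> W"
    have "0 \<le> 2 * (w \<bullet> (- y) - f (- y))" by (rule half) (use W(1) y subspace_neg in blast)
    with half[OF y] show "w \<bullet> y = f y" by (simp add: f.neg)
  qed
qed

lemma adjoint_inner:
  fixes A :: "'v::{real_inner, complete_space} \<Rightarrow> 'h::real_inner"
  assumes "bounded_linear A"
  shows "x \<bullet> adjoint A y = A x \<bullet> y"
proof -
  have "\<exists>z. \<forall>x. A x \<bullet> y = x \<bullet> z" for y
  proof -
    have "bounded_linear (\<lambda>x. A x \<bullet> y)"
      using assms by (rule bounded_linear_inner_left_comp)
    then obtain z where "\<forall>x. z \<bullet> x = A x \<bullet> y"
      using riesz_representation_on_closed_subspace[OF subspace_UNIV closed_UNIV] by fastforce
    then have "\<forall>x. A x \<bullet> y = x \<bullet> z" by (simp add: inner_commute)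
    then show ?thesis ..
  qed
  then have "\<exists>B. \<forall>x y. A x \<bullet> y = x \<bullet> B y" by metis
  then have "\<forall>x y. A x \<bullet> y = x \<bullet> adjoint A y" unfolding adjoint_def by (rule someI_ex)
  then show ?thesis by simp
qed

lemma linear_adjoint_Hilbert:
  fixes A :: "'v::{real_inner, complete_space} \<Rightarrow> 'h::real_inner"
  assumes A: "bounded_linear A"
  shows "linear (adjoint A)"
proof (rule linearI)
  show "adjoint A (y + z) = adjoint A y + adjoint A z" for y z
  proof -
    have "x \<bullet> adjoint A (y + z) = x \<bullet> (adjoint A y + adjoint A z)" for x
      by (simp only: inner_add_right adjoint_inner[OF A])
    then show ?thesis using vector_eq_ldot by blast
  qed
  show "adjoint A (c *\<^sub>R y) = c *\<^sub>R adjoint A y" for c y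
  proof -
    have "x \<bullet> adjoint A (c *\<^sub>R y) = x \<bullet> (c *\<^sub>R adjoint A y)" for x
      by (simp only: inner_scaleR_right adjoint_inner[OF A])
    then show ?thesis using vector_eq_ldot by blast
  qed
qed

lemma orth_proj_decomposition:
  fixes W :: "'a::{real_inner, complete_space} set"
  assumes W: "subspace W" "closed W"
  shows "orth_proj W x \<in> W \<and> x - orth_proj W x \<in> W\<^sup>\<bottom>"
  unfolding orth_proj_def
proof (rule theI')
  obtain y where y: "y \<in> W" "\<And>z. z \<in> W \<Longrightarrow> y \<bullet> z = x \<bullet> z"
    using riesz_representation_on_closed_subspace[OF W bounded_linear_inner_right[of x]] by auto
  show "\<exists>!y. y \<in> W \<and> x - y \<in> W\<^sup>\<bottom>"
  proof (rule ex1I[of _ y])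
    show "y \<in> W \<and> x - y \<in> W\<^sup>\<bottom>"
      using y by (simp add: orthogonal_comp_def orthogonal_def inner_diff inner_commute)
  next
    fix y' assume y': "y' \<in> W \<and> x - y' \<in> W\<^sup>\<bottom>"
    have d: "y - y' \<in> W" using W(1) y(1) y' subspace_diff by blast
    then have "(y - y') \<bullet> (x - y') = 0" "y \<bullet> (y - y') = x \<bullet> (y - y')"
      using y' y(2) by (auto simp: orthogonal_comp_def orthogonal_def)
    then have "(y - y') \<bullet> (y - y') = 0" by (simp add: inner_diff inner_commute)
    then show "y' = y" by simp
  qed
qed

text \<open>
  This one identity says that \<open>x - P x\<close> is orthogonal to the range of \<open>P\<close>; by symmetry of the
  inner product it yields both that \<open>P\<close> is self-adjoint and that \<open>P\<close> is idempotent.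
\<close>

lemma orthogonal_projector_inner:
  fixes P :: "'a::{real_inner, complete_space} \<Rightarrow> 'a"
  assumes "orthogonal_projector P"
  shows "P x \<bullet> y = P x \<bullet> P y"
proof -
  obtain W where W: "subspace W" "closed W" "P = orth_proj W"
    using assms unfolding orthogonal_projector_def by blast
  have "P x \<bullet> (y - P y) = 0"
    using orth_proj_decomposition[OF W(1,2)] unfolding W(3)
    by (simp add: orthogonal_comp_def orthogonal_def)
  then show ?thesis by (simp add: inner_diff)
qed

section \<open>Optimality conditions for the dual minimizer\<close>

text \<open>
  The quadratic and linear terms are differentiated in the direction \<open>h\<close>. The increment of the
  nonsmooth term is bounded by the triangle inequality, which also covers the case \<open>p = P p\<close>, where
  the norm is not differentiable.
\<close>

lemma dual_minimizer_variational_inequality: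
  fixes A :: "'v::{real_inner, complete_space} \<Rightarrow> 'h::real_inner"
  assumes A: "bounded_linear A" and P: "linear P" and "0 \<le> \<delta>"
    and min: "\<And>q. dual_functional A P \<delta> g p \<le> dual_functional A P \<delta> g q"
  shows "0 \<le> (A (adjoint A p) - g) \<bullet> h + \<delta> * norm (h - P h)"
proof (rule nonneg_of_small_quadratic)
  fix t :: real assume t: "0 < t" "t < 1"
  interpret B: linear "adjoint A" by (rule linear_adjoint_Hilbert[OF A])
  interpret P: linear P by (rule P)
  have "(p + t *\<^sub>R h) - P (p + t *\<^sub>R h) = (p - P p) + t *\<^sub>R (h - P h)"
    by (simp add: P.add P.scale algebra_simps)
  moreover have "norm (t *\<^sub>R (h - P h)) = t * norm (h - P h)" using t by simp
  ultimately have "norm ((p + t *\<^sub>R h) - P (p + t *\<^sub>R h)) \<le> norm (p - P p) + t * norm (h - P h)"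
    using norm_triangle_ineq[of "p - P p" "t *\<^sub>R (h - P h)"]
    by metis
  from mult_left_mono[OF this \<open>0 \<le> \<delta>\<close>]
  have "\<delta> * norm ((p + t *\<^sub>R h) - P (p + t *\<^sub>R h))
      \<le> \<delta> * norm (p - P p) + t * (\<delta> * norm (h - P h))"
    by (simp add: algebra_simps)
  moreover have "(norm (adjoint A (p + t *\<^sub>R h)))\<^sup>2
      = (norm (adjoint A p))\<^sup>2 + 2 * t * (A (adjoint A p) \<bullet> h) + t\<^sup>2 * (norm (adjoint A h))\<^sup>2"
    unfolding adjoint_inner[OF A, symmetric] power2_norm_eq_inner B.add B.scale
    by (simp add: algebra_simps inner_commute power2_eq_square)
  moreover have "g \<bullet> (p + t *\<^sub>R h) = g \<bullet> p + t * (g \<bullet> h)"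
    by (simp add: inner_add)
  ultimately show "0 \<le> t * ((A (adjoint A p) - g) \<bullet> h + \<delta> * norm (h - P h))
      + t\<^sup>2 * (1/2 * (norm (adjoint A h))\<^sup>2)"
    using min[of "p + t *\<^sub>R h"] unfolding dual_functional_def
    by (simp add: algebra_simps)
qed

text \<open>
  Along the ray through \<open>p\<close> the nonsmooth term is linear, so here the derivative is exact. The
  variational inequality with \<open>h = - p\<close> would give only
  \<open>\<parallel>A* p\<parallel>\<^sup>2 \<le> (g, p) + \<delta> \<parallel>(I - P) p\<parallel>\<close>, because the triangle inequality loses the sign.
\<close>

lemma dual_minimizer_scaling_inequality:
  fixes A :: "'v::{real_inner, complete_space} \<Rightarrow> 'h::real_inner"
  assumes A: "bounded_linear A" and P: "linear P"
    and min: "\<And>q. dual_functional A P \<delta> g p \<le> dual_functional A P \<delta> g q"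
  shows "(norm (adjoint A p))\<^sup>2 \<le> g \<bullet> p - \<delta> * norm (p - P p)"
proof -
  interpret B: linear "adjoint A" by (rule linear_adjoint_Hilbert[OF A])
  interpret P: linear P by (rule P)
  have "0 \<le> g \<bullet> p - \<delta> * norm (p - P p) - (norm (adjoint A p))\<^sup>2"
  proof (rule nonneg_of_small_quadratic)
    fix t :: real assume t: "0 < t" "t < 1"
    have "(1 - t) *\<^sub>R p - P ((1 - t) *\<^sub>R p) = (1 - t) *\<^sub>R (p - P p)"
      by (simp only: P.scale scaleR_diff_right)
    moreover have "norm ((1 - t) *\<^sub>R (p - P p)) = (1 - t) * norm (p - P p)"
      using t by simp
    ultimately have "norm ((1 - t) *\<^sub>R p - P ((1 - t) *\<^sub>R p)) = (1 - t) * norm (p - P p)"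
      by (simp only:)
    moreover have "(norm ((1 - t) *\<^sub>R adjoint A p))\<^sup>2 = (1 - t)\<^sup>2 * (norm (adjoint A p))\<^sup>2"
      by (simp add: power_mult_distrib)
    ultimately show "0 \<le> t * (g \<bullet> p - \<delta> * norm (p - P p) - (norm (adjoint A p))\<^sup>2)
        + t\<^sup>2 * (1/2 * (norm (adjoint A p))\<^sup>2)"
      using min[of "(1 - t) *\<^sub>R p"] unfolding dual_functional_def B.scale
      by (simp only: inner_scaleR_right) (simp add: power2_eq_square field_simps)
  qed
  then show ?thesis by simp
qed

section \<open>The dual minimizer solves the primal problem\<close>

theorem theorem2p3:
  fixes A :: "'v::{real_inner, complete_space} \<Rightarrow> 'h::{real_inner, complete_space}"
    and P :: "'h \<Rightarrow> 'h"
    and \<delta> :: real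
    and g p :: 'h
  assumes "bounded_linear A"
    and "inj A"
    and "orthogonal_projector P"
    and "compact_operator P"
    and "range P \<subseteq> closure (range A)"
    and "\<delta> > 0"
    and "norm (orth_proj ((range A)\<^sup>\<bottom>) g) < \<delta>"
    and "is_arg_min (dual_functional A P \<delta> g) (\<lambda>q. q \<in> UNIV) p"
  shows "is_arg_min (\<lambda>v. (norm v)\<^sup>2) (\<lambda>v. v \<in> feasible_set A P \<delta> g) (adjoint A p) \<and>
         (\<forall>u. is_arg_min (\<lambda>v. (norm v)\<^sup>2) (\<lambda>v. v \<in> feasible_set A P \<delta> g) u
                \<longrightarrow> u = adjoint A p)"
proof -
  have P: "linear P"
    using assms(4) by (simp add: compact_operator_def bounded_linear.linear)
  have min: "dual_functional A P \<delta> g p \<le> dual_functional A P \<delta> g q" for q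
    using assms(8) by (simp add: is_arg_min_def not_less)
  note P_inner = orthogonal_projector_inner[OF assms(3)]
  define u where "u = adjoint A p"
  define r where "r = A u - g"
  have variational: "0 \<le> r \<bullet> h + \<delta> * norm (h - P h)" for h
    unfolding r_def u_def
    using dual_minimizer_variational_inequality[OF assms(1) P _ min] \<open>\<delta> > 0\<close> by simp
  have PP: "P (P x) = P x" for x
  proof -
    have "(P (P x) - P x) \<bullet> (P (P x) - P x) = 0"
      using P_inner[of "P x" "P x"] P_inner[of "P x" x] P_inner[of x "P x"]
      by (simp add: inner_diff inner_commute)
    then show ?thesis by simp
  qed
  have Pr: "P r = 0"
  proof -
    have "0 \<le> r \<bullet> (- P r)"
      using variational[of "- P r"] by (simp add: linear_neg[OF P] PP)
    then have "P r \<bullet> P r \<le> 0"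
      using P_inner[of r r] by (simp add: inner_commute)
    then show ?thesis using inner_ge_zero[of "P r"] inner_eq_zero_iff[of "P r"] by linarith
  qed
  have "norm r \<le> \<delta>"
  proof -
    have "norm r * norm r \<le> \<delta> * norm r"
      using variational[of "- r"]
      by (simp add: linear_neg[OF P] Pr flip: power2_norm_eq_inner power2_eq_square)
    then show ?thesis using \<open>\<delta> > 0\<close> by (cases "norm r = 0") auto
  qed
  then have u_feasible: "u \<in> feasible_set A P \<delta> g"
    using Pr by (simp add: feasible_set_def r_def linear_diff[OF P])
  have obtuse: "(norm u)\<^sup>2 \<le> v \<bullet> u" if "v \<in> feasible_set A P \<delta> g" for v
  proof -
    define s where "s = A v - g"
    have s: "norm s \<le> \<delta>" "P s = 0"
      using that by (simp_all add: feasible_set_def s_def linear_diff[OF P])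
    have "P p \<bullet> s = 0" using P_inner[of p s] s(2) by simp
    then have "s \<bullet> p = s \<bullet> (p - P p)" by (simp add: inner_diff inner_commute)
    moreover have "\<bar>s \<bullet> (p - P p)\<bar> \<le> \<delta> * norm (p - P p)"
      using Cauchy_Schwarz_ineq2 mult_right_mono[OF s(1) norm_ge_zero] by (rule order_trans)
    ultimately have "g \<bullet> p - \<delta> * norm (p - P p) \<le> g \<bullet> p + s \<bullet> p" by linarith
    also have "\<dots> = v \<bullet> u"
      unfolding u_def adjoint_inner[OF assms(1)] by (simp add: s_def inner_diff)
    finally show ?thesis
      using dual_minimizer_scaling_inequality[OF assms(1) P min] unfolding u_def by linarith
  qed
  have dist_bound: "(norm (v - u))\<^sup>2 \<le> (norm v)\<^sup>2 - (norm u)\<^sup>2"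
    if "v \<in> feasible_set A P \<delta> g" for v
    using obtuse[OF that] by (simp add: power2_norm_eq_inner inner_diff inner_commute)
  have "is_arg_min (\<lambda>v. (norm v)\<^sup>2) (\<lambda>v. v \<in> feasible_set A P \<delta> g) u"
    unfolding is_arg_min_def
    using u_feasible dist_bound zero_le_power2 by (smt (verit))
  moreover have "v = u"
    if v: "is_arg_min (\<lambda>v. (norm v)\<^sup>2) (\<lambda>v. v \<in> feasible_set A P \<delta> g) v" for v
  proof -
    have "v \<in> feasible_set A P \<delta> g" "(norm v)\<^sup>2 \<le> (norm u)\<^sup>2"
      using v u_feasible by (auto simp: is_arg_min_def not_less)
    then have "(norm (v - u))\<^sup>2 \<le> 0" using dist_bound[of v] by linarith
    then show ?thesis by simp
  qed
  ultimately show ?thesis unfolding u_def by blast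
qed

end
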